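(* Let $R$ be a commutative ring with identity in which the positive integer multiples of the identity $1_R$ are not zero divisors, and let $N \ge 2$ be an integer. A polynomial $p \in R[X_1,\ldots,X_N]$ satisfies $M_{jk}p=0$ for all distinct $j,k\in\{1,\ldots,N\}$ if and only if $p = q(X_1^2+\cdots+X_N^2)$ for some $q(T) \in R[T]$. If such a $p$ is (nonzero and) homogeneous of degree $d$, then $d$ is even and $q(T) = cT^{d/2}$ for some $c \in R$.
   Context: For distinct $j,k$, $M_{jk} = X_j\partial_k - X_k\partial_j$ acting on $R[X_1,\ldots,X_N]$, where $\partial_j = \partial/\partial X_j$. An element $a\in R$ is "not a zero divisor" if $ab=0$ with $b\in R$ implies $b=0$ (so in particular the hypothesis says no positive multiple of $1_R$ is $0$). *)

theory Defs
  imports "HOL-Library.Poly_Mapping" "HOL-Computational_Algebra.Polynomial"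
begin

(* Polynomials in the variables X_i (i a natural number) over 'a: finitely supported maps from
   monomials (finitely supported exponent vectors) to coefficients.  The ring structure is the
   convolution product of Poly_Mapping. *)
type_synonym 'a mpoly = "(nat \<Rightarrow>\<^sub>0 nat) \<Rightarrow>\<^sub>0 'a"

(* The polynomial ring R[X_1, ..., X_N] inside 'a mpoly. *)
definition mpolys :: "nat \<Rightarrow> ('a::comm_ring_1) mpoly set" where
  "mpolys N = {p. \<forall>m \<in> Poly_Mapping.keys p. Poly_Mapping.keys m \<subseteq> {1..N}}"

definition Var :: "nat \<Rightarrow> ('a::comm_ring_1) mpoly" where
  "Var i = Poly_Mapping.single (Poly_Mapping.single i 1) 1"

definition Const :: "'a \<Rightarrow> ('a::comm_ring_1) mpoly" where
  "Const c = Poly_Mapping.single 0 c"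

(* Formal partial derivative.  The truncated subtraction of exponents is harmless: for monomials
   in which X_j does not occur the coefficient is multiplied by 0. *)
definition pdiff :: "nat \<Rightarrow> ('a::comm_ring_1) mpoly \<Rightarrow> 'a mpoly" where
  "pdiff j p = (\<Sum>m \<in> Poly_Mapping.keys p.
     Poly_Mapping.single (m - Poly_Mapping.single j 1)
       (of_nat (Poly_Mapping.lookup m j) * Poly_Mapping.lookup p m))"

definition M_op :: "nat \<Rightarrow> nat \<Rightarrow> ('a::comm_ring_1) mpoly \<Rightarrow> 'a mpoly" where
  "M_op j k p = Var j * pdiff k p - Var k * pdiff j p"

definition sum_squares :: "nat \<Rightarrow> ('a::comm_ring_1) mpoly" where
  "sum_squares N = (\<Sum>i = 1..N. (Var i)\<^sup>2)"

definition subst_poly :: "('a::comm_ring_1) poly \<Rightarrow> 'a mpoly \<Rightarrow> 'a mpoly" where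
  "subst_poly q f = poly (map_poly Const q) f"

definition mdegree :: "(nat \<Rightarrow>\<^sub>0 nat) \<Rightarrow> nat" where
  "mdegree m = (\<Sum>i \<in> Poly_Mapping.keys m. Poly_Mapping.lookup m i)"

(* The zero polynomial is homogeneous of every degree. *)
definition homogeneous :: "nat \<Rightarrow> ('a::comm_ring_1) mpoly \<Rightarrow> bool" where
  "homogeneous d p \<longleftrightarrow> (\<forall>m \<in> Poly_Mapping.keys p. mdegree m = d)"

(* In particular, 0 is a zero divisor in a nontrivial ring. *)
definition not_zero_divisor :: "'a::comm_ring_1 \<Rightarrow> bool" where
  "not_zero_divisor a \<longleftrightarrow> (\<forall>b. a * b = 0 \<longrightarrow> b = 0)"

end

theory Submission
  imports Defs
begin

text \<open>
  Comparing coefficients in \<open>M\<^sub>j\<^sub>k p = 0\<close> shows that a monomial with an odd exponent has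
  coefficient 0, and relates the coefficients of the monomials \<open>v X\<^sub>j\<^sup>2\<close> and \<open>v X\<^sub>k\<^sup>2\<close>, so that
  \<open>p\<close> is determined by the coefficients of the powers \<open>X\<^sub>1\<^bsup>2n\<^esup>\<close>. The polynomial with these
  coefficients substituted at \<open>X\<^sub>1\<^sup>2 + \<dots> + X\<^sub>N\<^sup>2\<close> is also annihilated by every \<open>M\<^sub>j\<^sub>k\<close>, because \<open>M\<^sub>j\<^sub>k\<close>
  is a derivation, and it agrees with \<open>p\<close> at these powers.
\<close>

section \<open>Coefficients and derivations\<close>

text \<open>Reduces identities additive in the polynomial to single monomials: updating at a key
  outside the support is the same as adding a monomial. Zero is covered by \<open>single\<close>
  with coefficient 0.\<close>

lemma mpoly_add_induct [case_names single add]: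
  fixes p :: "'b \<Rightarrow>\<^sub>0 'a::comm_monoid_add"
  assumes single: "\<And>m c. P (Poly_Mapping.single m c)"
    and add: "\<And>p q. P p \<Longrightarrow> P q \<Longrightarrow> P (p + q)"
  shows "P p"
proof (induction p rule: update_induct)
  case const
  show ?case using single[of undefined 0] by simp
next
  case (update p m c)
  have "Poly_Mapping.update m c p = p + Poly_Mapping.single m c"
    by (rule poly_mapping_eqI)
      (use update(1) in \<open>auto simp: lookup_update lookup_add lookup_single in_keys_iff when_def\<close>)
  then show ?case using add[OF update(3) single] by simp
qed

text \<open>Multiplication by a monomial shifts exponents injectively. Together with the next lemma,
  on monomials not divisible by \<open>a\<close>, this determines every coefficient of the
  product.\<close>

lemma lookup_single_times_add:
  fixes p :: "('a::comm_ring_1) mpoly"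
  shows "Poly_Mapping.lookup (Poly_Mapping.single a c * p) (a + n) = c * Poly_Mapping.lookup p n"
  by (induction p rule: mpoly_add_induct)
    (auto simp: mult_single lookup_single lookup_add distrib_left when_def)

lemma lookup_single_times_eq_0:
  fixes p :: "('a::comm_ring_1) mpoly"
  assumes "Poly_Mapping.lookup n i < Poly_Mapping.lookup a i"
  shows "Poly_Mapping.lookup (Poly_Mapping.single a c * p) n = 0"
  by (induction p rule: mpoly_add_induct)
    (use assms in \<open>auto simp: mult_single lookup_single lookup_add algebra_simps when_def\<close>)

lemma minus_single_add_cancel:
  fixes m :: "nat \<Rightarrow>\<^sub>0 nat"
  assumes "Poly_Mapping.lookup m j > 0"
  shows "m - Poly_Mapping.single j 1 + Poly_Mapping.single j 1 = m"
  by (rule poly_mapping_eqI)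
    (use assms in \<open>auto simp: lookup_add lookup_minus lookup_single when_def\<close>)

lemma lookup_pdiff:
  "Poly_Mapping.lookup (pdiff j p) n =
     of_nat (Suc (Poly_Mapping.lookup n j)) * Poly_Mapping.lookup p (n + Poly_Mapping.single j 1)"
proof -
  have "Poly_Mapping.lookup (pdiff j p) n = (\<Sum>m\<in>Poly_Mapping.keys p.
     if m = n + Poly_Mapping.single j 1
     then of_nat (Suc (Poly_Mapping.lookup n j)) * Poly_Mapping.lookup p (n + Poly_Mapping.single j 1)
     else 0)"
    unfolding pdiff_def lookup_sum
  proof (rule sum.cong[OF refl], goal_cases)
    case (1 m)
    \<comment> \<open>Any other monomial reaches \<open>n\<close> only through truncated subtraction
      at exponent 0, where its factor vanishes.\<close>
    have "Poly_Mapping.lookup m j = 0"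
      if "m \<noteq> n + Poly_Mapping.single j 1" "m - Poly_Mapping.single j 1 = n"
      using minus_single_add_cancel[of m j] that by auto
    then show ?case
      by (auto simp: lookup_single when_def lookup_add)
  qed
  also have "\<dots> = of_nat (Suc (Poly_Mapping.lookup n j)) *
      Poly_Mapping.lookup p (n + Poly_Mapping.single j 1)"
    by (auto simp: sum.delta in_keys_iff)
  finally show ?thesis .
qed

lemma pdiff_add: "pdiff j (p + q) = pdiff j p + pdiff j q"
  by (rule poly_mapping_eqI) (simp add: lookup_pdiff lookup_add algebra_simps)

lemma pdiff_0: "pdiff j 0 = 0"
  by (simp add: pdiff_def)

lemma pdiff_sum: "pdiff j (\<Sum>i\<in>A. f i) = (\<Sum>i\<in>A. pdiff j (f i))"
  by (induction A rule: infinite_finite_induct) (auto simp: pdiff_0 pdiff_add)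

lemma pdiff_minus: "pdiff j (p - q) = pdiff j p - pdiff j q"
  by (rule poly_mapping_eqI) (simp add: lookup_pdiff lookup_minus algebra_simps)

lemma pdiff_single:
  "pdiff j (Poly_Mapping.single m c) =
     Poly_Mapping.single (m - Poly_Mapping.single j 1) (of_nat (Poly_Mapping.lookup m j) * c)"
  by (auto simp: pdiff_def)

text \<open>Truncated subtraction commutes with adding \<open>n\<close> if X_j occurs in
  \<open>m\<close>; otherwise both coefficients are 0. This settles the Leibniz rule on
  monomials.\<close>

lemma single_minus_add:
  fixes c :: "'a::comm_ring_1" and m n :: "nat \<Rightarrow>\<^sub>0 nat"
  shows "Poly_Mapping.single (m - Poly_Mapping.single j 1 + n) (of_nat (Poly_Mapping.lookup m j) * c) =
    Poly_Mapping.single (m + n - Poly_Mapping.single j 1) (of_nat (Poly_Mapping.lookup m j) * c)"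
proof (cases "Poly_Mapping.lookup m j = 0")
  case False
  then have "m - Poly_Mapping.single j 1 + n = m + n - Poly_Mapping.single j 1"
    by (intro poly_mapping_eqI) (auto simp: lookup_add lookup_minus lookup_single when_def)
  then show ?thesis by simp
qed simp

lemma pdiff_mult: "pdiff j (p * q) = pdiff j p * q + p * pdiff j q"
proof (induction p rule: mpoly_add_induct)
  case (single m c)
  show ?case
  proof (induction q rule: mpoly_add_induct)
    case (single n d)
    show ?case
      using single_minus_add[of m j n "c * d"] single_minus_add[of n j m "c * d"]
      by (simp add: pdiff_single mult_single lookup_add single_add algebra_simps)
  qed (simp add: algebra_simps pdiff_add)
qed (simp add: algebra_simps pdiff_add)

lemma M_op_mult: "M_op j k (p * q) = M_op j k p * q + p * M_op j k q"
  by (simp add: M_op_def pdiff_mult algebra_simps)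

lemma M_op_add: "M_op j k (p + q) = M_op j k p + M_op j k q"
  by (simp add: M_op_def pdiff_add algebra_simps)

lemma M_op_minus: "M_op j k (p - q) = M_op j k p - M_op j k q"
  by (simp add: M_op_def pdiff_minus algebra_simps)

lemma M_op_Const: "M_op j k (Const c) = 0"
  by (simp add: M_op_def Const_def pdiff_single)

text \<open>Each partial derivative is 2 X_i, so the result is X_j (2 X_k) - X_k (2 X_j).\<close>

lemma M_op_sum_squares:
  assumes "j \<in> {1..N}" "k \<in> {1..N}"
  shows "M_op j k (sum_squares N :: ('a::comm_ring_1) mpoly) = 0"
proof -
  have "pdiff i (sum_squares N :: 'a mpoly) = 2 * Var i" if "i \<in> {1..N}" for i
  proof -
    have "pdiff i ((Var l)\<^sup>2 :: 'a mpoly) = (if l = i then 2 * Var i else 0)" for l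
      by (auto simp: power2_eq_square pdiff_mult Var_def pdiff_single lookup_single)
    then show ?thesis using that by (simp add: sum_squares_def pdiff_sum)
  qed
  then show ?thesis using assms by (simp add: M_op_def)
qed

section \<open>Substitution of the sum of squares\<close>

lemma subst_poly_0: "subst_poly 0 f = 0"
  by (simp add: subst_poly_def)

lemma subst_poly_pCons: "subst_poly (pCons a q) f = Const a + f * subst_poly q f"
  by (simp add: subst_poly_def map_poly_pCons Const_def)

text \<open>Induction along the Horner scheme: a derivation that kills the constants and the sum of
  squares kills every polynomial in the latter.\<close>

lemma M_op_subst_sum_squares:
  assumes "j \<in> {1..N}" "k \<in> {1..N}"
  shows "M_op j k (subst_poly q (sum_squares N)) = 0"
  by (induction q)
    (simp_all add: subst_poly_0 subst_poly_pCons M_op_add M_op_mult M_op_Const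
      M_op_sum_squares[OF assms], simp add: M_op_def pdiff_0)

lemma mpolys_add: "p \<in> mpolys N \<Longrightarrow> q \<in> mpolys N \<Longrightarrow> p + q \<in> mpolys N"
  unfolding mpolys_def using keys_add[of p q] by blast

lemma mpolys_minus: "p \<in> mpolys N \<Longrightarrow> q \<in> mpolys N \<Longrightarrow> p - q \<in> mpolys N"
  unfolding mpolys_def using keys_diff[of p q] by blast

lemma mpolys_mult:
  assumes "p \<in> mpolys N" "q \<in> mpolys N"
  shows "p * q \<in> mpolys N"
  unfolding mpolys_def
proof (intro CollectI ballI)
  fix m assume "m \<in> Poly_Mapping.keys (p * q)"
  then obtain a b where "a \<in> Poly_Mapping.keys p" "b \<in> Poly_Mapping.keys q" "m = a + b"
    using keys_mult[of p q] by blast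
  then show "Poly_Mapping.keys m \<subseteq> {1..N}"
    using assms keys_add[of a b] unfolding mpolys_def by blast
qed

lemma mpolys_sum: "(\<And>i. i \<in> A \<Longrightarrow> f i \<in> mpolys N) \<Longrightarrow> sum f A \<in> mpolys N"
  by (induction A rule: infinite_finite_induct) (auto simp: mpolys_add, auto simp: mpolys_def)

lemma mpolys_Const: "Const c \<in> mpolys N"
  by (simp add: mpolys_def Const_def)

lemma mpolys_Var: "i \<in> {1..N} \<Longrightarrow> Var i \<in> mpolys N"
  by (simp add: mpolys_def Var_def)

lemma mpolys_subst_sum_squares: "subst_poly q (sum_squares N) \<in> mpolys N"
proof (induction q)
  case 0
  show ?case by (simp add: subst_poly_0 mpolys_def)
next
  case (pCons a q)
  have "sum_squares N \<in> mpolys N"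
    by (auto simp: sum_squares_def power2_eq_square intro!: mpolys_sum mpolys_mult mpolys_Var)
  with pCons show ?case
    by (auto simp: subst_poly_pCons intro!: mpolys_add mpolys_mult mpolys_Const)
qed

text \<open>Setting X_2, ..., X_N to 0 turns the substitution into q(X_1^2), so the pure powers of
  X_1 reveal the coefficients of \<open>q\<close>.\<close>

lemma lookup_subst_sum_squares:
  assumes "N \<ge> 1"
  shows "Poly_Mapping.lookup (subst_poly q (sum_squares N)) (Poly_Mapping.single 1 (2 * n)) = coeff q n"
proof (induction q arbitrary: n)
  case 0
  show ?case by (simp add: subst_poly_0)
next
  case (pCons a q)
  let ?r = "subst_poly q (sum_squares N)"
  have Var2: "(Var i)\<^sup>2 = Poly_Mapping.single (Poly_Mapping.single i 2) (1::'a)" for i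
    by (simp add: Var_def numeral_2_eq_2 mult_single flip: single_add)
  \<comment> \<open>X_i^2 divides X_1^(2n) only for i = 1 and n > 0; in that case the index drops by
    one.\<close>
  have "Poly_Mapping.lookup ((Var i)\<^sup>2 * ?r) (Poly_Mapping.single 1 (2 * n)) =
      (if i = 1 then case n of 0 \<Rightarrow> 0 | Suc l \<Rightarrow> coeff q l else 0)" for i
  proof (cases "i = 1 \<and> n > 0")
    case True
    then obtain l where l: "n = Suc l" using gr0_implies_Suc by blast
    have "Poly_Mapping.single (1::nat) (2 * n) = Poly_Mapping.single 1 2 + Poly_Mapping.single 1 (2 * l)"
      by (simp add: l flip: single_add)
    then show ?thesis
      using True by (simp add: Var2 lookup_single_times_add pCons.IH[unfolded One_nat_def] l
          del: mult_Suc_right)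
  next
    case False
    then show ?thesis unfolding Var2
      by (subst lookup_single_times_eq_0[where i = i]) (auto simp: lookup_single when_def split: nat.splits)
  qed
  then have "Poly_Mapping.lookup (sum_squares N * ?r) (Poly_Mapping.single 1 (2 * n)) =
      (case n of 0 \<Rightarrow> 0 | Suc l \<Rightarrow> coeff q l)"
    using assms by (simp add: sum_squares_def sum_distrib_right lookup_sum)
  then show ?case
    by (auto simp: subst_poly_pCons lookup_add Const_def lookup_single when_def coeff_pCons
        split: nat.splits dest: arg_cong[where f = "\<lambda>m. Poly_Mapping.lookup m (1::nat)"])
qed

section \<open>Polynomials annihilated by all rotations\<close>

text \<open>Compare coefficients at X_j u, which is free of X_k: the term with factor X_k
  contributes nothing, and the derivative in X_k contributes the factor 1.\<close>

lemma M_op_eq_0_exponent_1: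
  assumes "M_op j k p = 0" "j \<noteq> k" "Poly_Mapping.lookup u k = 0"
  shows "Poly_Mapping.lookup p (u + Poly_Mapping.single k 1) = 0"
proof -
  let ?e = "\<lambda>i. Poly_Mapping.single i (1::nat)"
  have "Poly_Mapping.lookup (M_op j k p) (?e j + u) = 0" using assms by simp
  moreover have "Poly_Mapping.lookup (Var k * pdiff j p) (?e j + u) = 0"
    unfolding Var_def by (rule lookup_single_times_eq_0[where i = k])
      (use assms in \<open>auto simp: lookup_add lookup_single\<close>)
  ultimately show ?thesis
    using assms(3) unfolding M_op_def lookup_minus Var_def lookup_single_times_add lookup_pdiff by simp
qed

text \<open>Compare coefficients at X_j X_k v: each of the two terms of \<open>M_op\<close>
  contributes one side.\<close>

lemma M_op_eq_0_squares:
  assumes "M_op j k p = 0" "j \<noteq> k"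
  shows "of_nat (Poly_Mapping.lookup v k + 2) * Poly_Mapping.lookup p (v + Poly_Mapping.single k 2) =
    of_nat (Poly_Mapping.lookup v j + 2) * Poly_Mapping.lookup p (v + Poly_Mapping.single j 2)"
proof -
  let ?e = "\<lambda>i. Poly_Mapping.single i (1::nat)"
  have two: "v + ?e i + ?e i = v + Poly_Mapping.single i 2" for i
    by (simp add: add.assoc numeral_2_eq_2 flip: single_add)
  have "Poly_Mapping.lookup (M_op j k p) (?e j + (v + ?e k)) = 0" using assms by simp
  moreover have "Poly_Mapping.lookup (Var k * pdiff j p) (?e j + (v + ?e k)) =
      Poly_Mapping.lookup (pdiff j p) (v + ?e j)"
    using lookup_single_times_add[of "?e k" 1 "pdiff j p" "v + ?e j"] by (simp add: Var_def add_ac)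
  ultimately show ?thesis
    unfolding M_op_def lookup_minus
    unfolding Var_def lookup_single_times_add lookup_pdiff two
    by (simp add: lookup_add)
qed

context
  fixes N :: nat and p :: "('a::comm_ring_1) mpoly"
  assumes nzd: "\<And>n::nat. n > 0 \<Longrightarrow> not_zero_divisor (of_nat n :: 'a)"
    and N: "N \<ge> 2"
    and M0: "\<And>j k. j \<in> {1..N} \<Longrightarrow> k \<in> {1..N} \<Longrightarrow> j \<noteq> k \<Longrightarrow> M_op j k p = 0"
begin

text \<open>The factor \<open>lookup v k + 2\<close> is a positive integer, hence cancellable by
  \<open>nzd\<close>. The relation thus lets vanishing pass from one index to the other without
  division.\<close>

lemma lookup_eq_0_transfer:
  assumes "j \<in> {1..N}" "k \<in> {1..N}" "j \<noteq> k"
    and "Poly_Mapping.lookup p (v + Poly_Mapping.single j 2) = 0"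
  shows "Poly_Mapping.lookup p (v + Poly_Mapping.single k 2) = 0"
  using M_op_eq_0_squares[OF M0[OF assms(1-3)] assms(3), of v] assms(4)
    nzd[of "Poly_Mapping.lookup v k + 2"]
  by (simp add: not_zero_divisor_def)

text \<open>Trading X_k^2 for X_j^2 lowers the exponent of X_k by 2 and keeps it odd, until it
  reaches 1.\<close>

lemma lookup_odd_eq_0:
  assumes "k \<in> {1..N}" "odd (Poly_Mapping.lookup m k)"
  shows "Poly_Mapping.lookup p m = 0"
  using assms(2)
proof (induction "Poly_Mapping.lookup m k" arbitrary: m rule: less_induct)
  case less
  \<comment> \<open>A second variable to trade with exists because \<open>N\<close> is at least
    2.\<close>
  obtain j where j: "j \<in> {1..N}" "j \<noteq> k"
    by (rule that[of "if k = 1 then 2 else 1"]) (use N in auto)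
  show ?case
  proof (cases "Poly_Mapping.lookup m k = 1")
    case True
    then show ?thesis
      using M_op_eq_0_exponent_1[OF M0[OF j(1) assms(1) j(2)] j(2), of "m - Poly_Mapping.single k 1"]
        minus_single_add_cancel[of m k]
      by (simp add: lookup_minus)
  next
    case False
    define v where "v = m - Poly_Mapping.single k 2"
    have ge: "Poly_Mapping.lookup m k \<ge> 2" using False less.prems by (cases "Poly_Mapping.lookup m k") auto
    then have m: "m = v + Poly_Mapping.single k 2"
      by (intro poly_mapping_eqI) (auto simp: v_def lookup_add lookup_minus lookup_single when_def)
    have "Poly_Mapping.lookup p (v + Poly_Mapping.single j 2) = 0"
      by (rule less.hyps) (use less.prems j m in \<open>auto simp: lookup_add lookup_single\<close>)
    then show ?thesis
      unfolding m using lookup_eq_0_transfer j assms(1) by blast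
  qed
qed

text \<open>Uniqueness: repeatedly trading X_k^2 for X_1^2 leads from any monomial with only even
  exponents to an even power of X_1.\<close>

lemma eq_0_if_first_powers_eq_0:
  assumes "p \<in> mpolys N"
    and "\<And>n. Poly_Mapping.lookup p (Poly_Mapping.single 1 (2 * n)) = 0"
  shows "p = 0"
proof (rule poly_mapping_eqI)
  fix m
  have "Poly_Mapping.lookup p m = 0" if "Poly_Mapping.keys m \<subseteq> {1..N}" for m
    using that
  \<comment> \<open>The measure is the total exponent outside X_1; each trade lowers it by
    2.\<close>
  proof (induction "\<Sum>i=2..N. Poly_Mapping.lookup m i" arbitrary: m rule: less_induct)
    case less
    show ?case
    proof (cases "(\<exists>i\<in>{1..N}. odd (Poly_Mapping.lookup m i)) \<or> (\<forall>i\<in>{2..N}. Poly_Mapping.lookup m i = 0)")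
      case True
      moreover have "Poly_Mapping.lookup p m = 0"
        if zero: "\<forall>i\<in>{2..N}. Poly_Mapping.lookup m i = 0" and "even (Poly_Mapping.lookup m 1)"
      proof -
        have "m = Poly_Mapping.single 1 (Poly_Mapping.lookup m 1)"
        proof (rule poly_mapping_eqI)
          fix i
          show "Poly_Mapping.lookup m i =
              Poly_Mapping.lookup (Poly_Mapping.single 1 (Poly_Mapping.lookup m 1)) i"
          proof (cases "i = 1 \<or> i \<in> {2..N}")
            case False
            then have "i \<notin> {1..N}" by auto
            then have "i \<notin> Poly_Mapping.keys m" using less.prems by blast
            then show ?thesis using False by (simp add: in_keys_iff lookup_single)
          qed (use zero in \<open>auto simp: lookup_single when_def\<close>)
        qed
        then show ?thesis using assms(2) that(2) by (metis evenE)
      qed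
      ultimately show ?thesis using lookup_odd_eq_0 N by force
    next
      case False
      then obtain k where k: "k \<in> {2..N}" "Poly_Mapping.lookup m k \<noteq> 0" by blast
      \<comment> \<open>A nonzero even exponent is at least 2, so a factor X_k^2 can be split
        off.\<close>
      moreover have "even (Poly_Mapping.lookup m k)" using False k by auto
      ultimately have ge: "Poly_Mapping.lookup m k \<ge> 2" by (auto elim!: evenE)
      define v where "v = m - Poly_Mapping.single k 2"
      have m: "m = v + Poly_Mapping.single k 2"
        using ge by (intro poly_mapping_eqI)
          (auto simp: v_def lookup_add lookup_minus lookup_single when_def)
      have "Poly_Mapping.lookup p (v + Poly_Mapping.single 1 2) = 0"
      proof (rule less.hyps)
        show "(\<Sum>i=2..N. Poly_Mapping.lookup (v + Poly_Mapping.single 1 2) i) <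
            (\<Sum>i=2..N. Poly_Mapping.lookup m i)"
          by (rule sum_strict_mono_ex1) (use k in \<open>auto simp: m lookup_add lookup_single when_def\<close>)
        have "Poly_Mapping.keys v \<subseteq> Poly_Mapping.keys m"
          by (auto simp: m in_keys_iff lookup_add)
        then show "Poly_Mapping.keys (v + Poly_Mapping.single 1 2) \<subseteq> {1..N}"
          using less.prems N keys_add[of v "Poly_Mapping.single 1 2"] by fastforce
      qed
      then show ?thesis
        unfolding m using lookup_eq_0_transfer[of 1 k v] k by auto
    qed
  qed
  then show "Poly_Mapping.lookup p m = Poly_Mapping.lookup 0 m"
    using assms(1) by (cases "m \<in> Poly_Mapping.keys p")
      (simp_all add: mpolys_def not_in_keys_iff_lookup_eq_zero)
qed

end

section \<open>The characterization and its homogeneous case\<close>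

theorem proposition2p3:
  fixes N :: nat and p :: "('a::comm_ring_1) mpoly"
  assumes "\<And>n::nat. n > 0 \<Longrightarrow> not_zero_divisor (of_nat n :: 'a)"
    and "N \<ge> 2"
    and "p \<in> mpolys N"
  shows "((\<forall>j\<in>{1..N}. \<forall>k\<in>{1..N}. j \<noteq> k \<longrightarrow> M_op j k p = 0)
           \<longleftrightarrow> (\<exists>q::'a poly. p = subst_poly q (sum_squares N)))
    \<and> (\<forall>d::nat. (\<forall>j\<in>{1..N}. \<forall>k\<in>{1..N}. j \<noteq> k \<longrightarrow> M_op j k p = 0)
           \<and> p \<noteq> 0 \<and> homogeneous d p
         \<longrightarrow> even d \<and> (\<forall>q::'a poly. p = subst_poly q (sum_squares N)
                \<longrightarrow> (\<exists>c. q = monom c (d div 2))))"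
proof -
  let ?M = "\<forall>j\<in>{1..N}. \<forall>k\<in>{1..N}. j \<noteq> k \<longrightarrow> M_op j k p = 0"
  have ex: "\<exists>q. p = subst_poly q (sum_squares N)" if M: ?M
  proof -
    \<comment> \<open>These values are forced: by \<open>lookup_subst_sum_squares\<close> any
      suitable \<open>q\<close> has them as coefficients.\<close>
    let ?c = "\<lambda>n. Poly_Mapping.lookup p (Poly_Mapping.single 1 (2 * n))"
    \<comment> \<open>The indices inject into the finite support of \<open>p\<close>, so
      \<open>Abs_poly\<close> yields a polynomial with exactly these coefficients.\<close>
    have "finite {n. ?c n \<noteq> 0}"
    proof (rule inj_on_finite)
      show "inj_on (\<lambda>n. Poly_Mapping.single (1::nat) (2 * n)) {n. ?c n \<noteq> 0}"
        by (rule inj_onI) (metis lookup_single_eq mult_left_cancel zero_neq_numeral)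
      show "(\<lambda>n. Poly_Mapping.single 1 (2 * n)) ` {n. ?c n \<noteq> 0} \<subseteq> Poly_Mapping.keys p"
        by (auto simp: in_keys_iff)
    qed simp
    then have coeff: "coeff (Abs_poly ?c) n = ?c n" for n
      by (subst Abs_poly_inverse) (auto simp: MOST_iff_cofinite)
    let ?s = "subst_poly (Abs_poly ?c) (sum_squares N)"
    have "p - ?s = 0"
    proof (rule eq_0_if_first_powers_eq_0[OF assms(1,2)])
      show "M_op j k (p - ?s) = 0" if "j \<in> {1..N}" "k \<in> {1..N}" "j \<noteq> k" for j k
        using M that by (simp add: M_op_minus M_op_subst_sum_squares)
      show "p - ?s \<in> mpolys N"
        by (intro mpolys_minus assms mpolys_subst_sum_squares)
      show "Poly_Mapping.lookup (p - ?s) (Poly_Mapping.single 1 (2 * n)) = 0" for n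
        using assms(2) by (simp only: lookup_minus lookup_subst_sum_squares coeff diff_self)
    qed
    then show ?thesis by auto
  qed
  \<comment> \<open>A nonzero coefficient of \<open>q\<close> at \<open>n\<close> makes X_1^(2n)
    occur in \<open>p\<close>. This yields both the parity of \<open>d\<close> and the monomial form
    of \<open>q\<close>.\<close>
  have degree: "d = 2 * n"
    if "homogeneous d p" "p = subst_poly q (sum_squares N)" "coeff q n \<noteq> 0" for d n q
  proof -
    have "Poly_Mapping.single 1 (2 * n) \<in> Poly_Mapping.keys p"
      using that assms(2) lookup_subst_sum_squares[of N q n] by (simp add: in_keys_iff)
    then have "mdegree (Poly_Mapping.single 1 (2 * n)) = d"
      using that by (simp add: homogeneous_def)
    then show ?thesis by (auto simp: mdegree_def split: if_splits)
  qed
  have "even d" if M: ?M and "p \<noteq> 0" "homogeneous d p" for d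
  proof -
    obtain q where q: "p = subst_poly q (sum_squares N)" using ex[OF M] by blast
    with \<open>p \<noteq> 0\<close> have "q \<noteq> 0" by (auto simp: subst_poly_0)
    \<comment> \<open>The leading coefficient of \<open>q\<close> is the required nonzero
      one.\<close>
    then show ?thesis using degree[OF that(3) q, of "degree q"] by simp
  qed
  moreover have "\<exists>c. q = monom c (d div 2)"
    if "homogeneous d p" "p = subst_poly q (sum_squares N)" for d q
  proof
    have "coeff q n = 0" if "n \<noteq> d div 2" for n
      using degree[OF \<open>homogeneous d p\<close> \<open>p = _\<close>, of n] that by (cases "coeff q n = 0") simp_all
    then show "q = monom (coeff q (d div 2)) (d div 2)" by (auto simp: poly_eq_iff)
  qed
  ultimately show ?thesis
    using ex by (auto simp: M_op_subst_sum_squares)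
qed

end
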